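(* For $\mu>0$, $x\ge 0$, $y>0$, the function $h_{\mu}(x,y)=P_{\mu+1}(x,y)/P_{\mu}(x,y)$ is increasing as a function of $y$, decreasing as a function of $x$, and decreasing as a function of $\mu$.
   Context: For $\mu>0$, $x>0$, $y\ge0$, the generalized Marcum $P$-function is $P_{\mu}(x,y)=x^{\frac12(1-\mu)}\int_0^{y} t^{\frac12(\mu-1)}e^{-t-x}I_{\mu-1}(2\sqrt{xt})\,dt$ ($I_\nu$ the modified Bessel function of the first kind); at $x=0$ it is defined by continuity, $P_\mu(0,y)=\gamma(\mu,y)/\Gamma(\mu)$ with $\gamma(\mu,y)=\int_0^y t^{\mu-1}e^{-t}dt$. *)

theory Defs
  imports "HOL-Analysis.Analysis"
begin

definition BesselI :: "real \<Rightarrow> real \<Rightarrow> real" where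
  "BesselI \<nu> z = (\<Sum>k. (z / 2) powr (2 * real k + \<nu>) / (fact k * Gamma (real k + \<nu> + 1)))"

definition lower_inc_gamma :: "real \<Rightarrow> real \<Rightarrow> real" where
  "lower_inc_gamma \<mu> y = (LBINT t=0..y. t powr (\<mu> - 1) * exp (- t))"

text \<open>Generalized Marcum P-function; at x = 0 defined by continuity.\<close>
definition MarcumP :: "real \<Rightarrow> real \<Rightarrow> real \<Rightarrow> real" where
  "MarcumP \<mu> x y =
     (if x = 0 then lower_inc_gamma \<mu> y / Gamma \<mu>
      else x powr ((1 - \<mu>) / 2) *
        (LBINT t=0..y. t powr ((\<mu> - 1) / 2) * exp (- t - x) * BesselI (\<mu> - 1) (2 * sqrt (x * t))))"

definition h_ratio :: "real \<Rightarrow> real \<Rightarrow> real \<Rightarrow> real" where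
  "h_ratio \<mu> x y = MarcumP (\<mu> + 1) x y / MarcumP \<mu> x y"

end

(* P_mu(x,y) is a Poisson mixture e^-x sum_k x^k/k! p(mu+k), where p(a) = gamma(a,y)/Gamma(a).
   Integration by parts gives p(a+1)/p(a) = 1 - 1/s(a) with s(a) = sum_n y^n/((a+1)...(a+n)),
   which is visibly decreasing in a and increasing in y.
   The ratio h is a weighted mean in two ways: of p(mu+k+1)/p(mu+k), which settles the dependence
   on x, and, for x > 0 and after an index shift, of k/x, with weights x^k/k! p(mu+k) both times.
   Replacing x, y or mu changes the weights by a factor monotone in k, so a Chebyshev-type
   inequality for weighted means gives all three claims. *)
theory Submission
  imports Defs
begin

section \<open>A Chebyshev-type inequality for weighted means\<close>

text \<open>Symmetrizing the right-hand side turns twice its value into a double sum of terms (c k -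
  c j) * (u j * v k - u k * v j). All of them are nonnegative, both factors changing sign when j and
  k are swapped. Keeping only the entries (0,1) and (1,0) leaves a lower bound independent of
  \<open>N\<close>, so strictness can survive the limit.\<close>

lemma sum_cross_product_ge:
  fixes c u v :: "nat \<Rightarrow> real"
  assumes c: "\<And>j k. j < k \<Longrightarrow> c j \<le> c k"
    and uv: "\<And>j k. j < k \<Longrightarrow> u k * v j \<le> u j * v k"
    and N: "2 \<le> N"
  shows "(c 1 - c 0) * (u 0 * v 1 - u 1 * v 0)
           \<le> (\<Sum>k<N. c k * v k) * (\<Sum>k<N. u k) - (\<Sum>k<N. c k * u k) * (\<Sum>k<N. v k)"
proof -
  define F where "F j k = (c k - c j) * (u j * v k - u k * v j)" for j k
  define A where "A = {..<N}"
  have F_nonneg: "0 \<le> F j k" for j k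
  proof (cases j k rule: linorder_cases)
    case less
    then show ?thesis using c[OF less] uv[OF less] by (simp add: F_def)
  next
    case greater
    then show ?thesis unfolding F_def using c[OF greater] uv[OF greater]
      by (intro mult_nonpos_nonpos) (auto simp: mult.commute)
  qed (simp add: F_def)
  have F_sym: "F j k = F k j" for j k by (simp add: F_def algebra_simps)
  have in_A: "0 \<in> A" "1 \<in> A" "finite A" using N by (auto simp: A_def)
  have e1: "(\<Sum>j\<in>A. \<Sum>k\<in>A. c k * v k * u j) = (\<Sum>k\<in>A. c k * v k) * (\<Sum>k\<in>A. u k)"
    by (subst sum.swap) (simp add: sum_product)
  have e2: "(\<Sum>j\<in>A. \<Sum>k\<in>A. c j * v j * u k) = (\<Sum>k\<in>A. c k * v k) * (\<Sum>k\<in>A. u k)"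
    by (simp add: sum_product)
  have e3: "(\<Sum>j\<in>A. \<Sum>k\<in>A. c k * u k * v j) = (\<Sum>k\<in>A. c k * u k) * (\<Sum>k\<in>A. v k)"
    by (subst sum.swap) (simp add: sum_product)
  have e4: "(\<Sum>j\<in>A. \<Sum>k\<in>A. c j * u j * v k) = (\<Sum>k\<in>A. c k * u k) * (\<Sum>k\<in>A. v k)"
    by (simp add: sum_product)
  have "(\<Sum>j\<in>A. \<Sum>k\<in>A. F j k)
      = (\<Sum>j\<in>A. \<Sum>k\<in>A. c k * v k * u j) + (\<Sum>j\<in>A. \<Sum>k\<in>A. c j * v j * u k)
        - (\<Sum>j\<in>A. \<Sum>k\<in>A. c k * u k * v j) - (\<Sum>j\<in>A. \<Sum>k\<in>A. c j * u j * v k)"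
    by (simp add: F_def sum.distrib[symmetric] sum_subtractf[symmetric] algebra_simps)
  then have eq: "(\<Sum>j\<in>A. \<Sum>k\<in>A. F j k)
      = 2 * ((\<Sum>k\<in>A. c k * v k) * (\<Sum>k\<in>A. u k) - (\<Sum>k\<in>A. c k * u k) * (\<Sum>k\<in>A. v k))"
    unfolding e1 e2 e3 e4 by simp
  have row: "F j k \<le> (\<Sum>k\<in>A. F j k)" if "k \<in> A" for j k
    using that in_A F_nonneg by (intro member_le_sum) auto
  \<comment> \<open>Each of the two entries is bounded by its row sum, and the two rows by the whole
    double sum. Since the entries are equal, they absorb the factor 2 of \<open>eq\<close>.\<close>
  have "F 0 1 + F 1 0 \<le> (\<Sum>k\<in>A. F 0 k) + (\<Sum>k\<in>A. F 1 k)"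
    using row in_A by (intro add_mono) auto
  also have "\<dots> = (\<Sum>j\<in>{0,1}. \<Sum>k\<in>A. F j k)" by simp
  also have "\<dots> \<le> (\<Sum>j\<in>A. \<Sum>k\<in>A. F j k)"
    using in_A F_nonneg by (intro sum_mono2) (auto intro!: sum_nonneg)
  finally show ?thesis
    using eq F_sym[of 1 0] by (simp add: F_def A_def)
qed

lemma weighted_mean_less:
  fixes c u v :: "nat \<Rightarrow> real"
  assumes c: "\<And>k. c k \<le> c (Suc k)" and c01: "c 0 < c 1"
    and v: "\<And>k. 0 < v k" and u: "\<And>k. 0 \<le> u k"
    and uv: "\<And>k. u (Suc k) / v (Suc k) \<le> u k / v k" and uv01: "u 1 / v 1 < u 0 / v 0"
    and sums: "summable u" "summable v" "summable (\<lambda>k. c k * u k)" "summable (\<lambda>k. c k * v k)"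
  shows "(\<Sum>k. c k * u k) / (\<Sum>k. u k) < (\<Sum>k. c k * v k) / (\<Sum>k. v k)"
proof -
  have c_le: "c j \<le> c k" if "j < k" for j k
    using lift_Suc_mono_le[of c j k] c that by simp
  have uv_le: "u k * v j \<le> u j * v k" if "j < k" for j k
  proof -
    have "u k / v k \<le> u j / v j"
      using lift_Suc_antimono_le[of "\<lambda>k. u k / v k" j k] uv that by simp
    then show ?thesis using v[of j] v[of k] by (simp add: field_simps)
  qed
  have uv_less: "u 1 * v 0 < u 0 * v 1"
    using uv01 v[of 0] v[of 1] by (simp add: field_simps)
  \<comment> \<open>The strict decrease of u/v at the first step forces \<open>u 0\<close> to be
    positive, so the sum of \<open>u\<close> is a legitimate denominator.\<close>
  have "0 < u 0 * v 1"
    using uv_less u[of 1] v[of 0] by (metis less_eq_real_def mult_nonneg_nonneg order_le_less_trans)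
  then have "0 < u 0" using v[of 1] by (simp add: zero_less_mult_iff)
  then have su: "0 < suminf u" using u sums by (intro suminf_pos2[where i = 0]) auto
  have sv: "0 < suminf v" using v sums by (intro suminf_pos) auto
  have "(\<lambda>N. (\<Sum>k<N. c k * v k) * (\<Sum>k<N. u k) - (\<Sum>k<N. c k * u k) * (\<Sum>k<N. v k))
      \<longlonglongrightarrow> (\<Sum>k. c k * v k) * (\<Sum>k. u k) - (\<Sum>k. c k * u k) * (\<Sum>k. v k)"
    by (intro tendsto_intros summable_LIMSEQ sums)
  then have "(c 1 - c 0) * (u 0 * v 1 - u 1 * v 0)
      \<le> (\<Sum>k. c k * v k) * (\<Sum>k. u k) - (\<Sum>k. c k * u k) * (\<Sum>k. v k)"
    using sum_cross_product_ge[of c u v, OF c_le uv_le] by (intro LIMSEQ_le_const) blast+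
  moreover have "0 < (c 1 - c 0) * (u 0 * v 1 - u 1 * v 0)"
    using c01 uv_less by simp
  ultimately show ?thesis using su sv by (simp add: field_simps)
qed

section \<open>The series s(a) and its monotonicity\<close>

text \<open>This is Kummer's function M(1, a+1, y).\<close>

definition inc_gamma_series :: "real \<Rightarrow> real \<Rightarrow> real" where
  "inc_gamma_series a y = (\<Sum>n. y ^ n / pochhammer (a + 1) n)"

lemma pochhammer_mono:
  fixes a b :: real
  assumes "0 < a" "a \<le> b"
  shows "pochhammer a n \<le> pochhammer b n"
  unfolding pochhammer_prod using assms by (intro prod_mono) auto

lemma fact_le_pochhammer:
  fixes a :: real
  assumes "0 < a"
  shows "fact n \<le> pochhammer (a + 1) n"
  using pochhammer_mono[of 1 "a + 1" n] assms by (simp add: pochhammer_fact)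

lemma inc_gamma_series_term_le:
  fixes a y :: real
  assumes "0 < a" "0 \<le> y"
  shows "y ^ n / pochhammer (a + 1) n \<le> y ^ n / fact n"
  using fact_le_pochhammer[OF assms(1)] assms
  by (intro divide_left_mono mult_pos_pos pochhammer_pos) auto

lemma summable_inc_gamma_series:
  assumes "0 < a" "0 \<le> y"
  shows "summable (\<lambda>n. y ^ n / pochhammer (a + 1) n :: real)"
proof (rule summable_comparison_test')
  show "summable (\<lambda>n. y ^ n / fact n)"
    using summable_exp[of y] by (simp add: field_simps)
  show "norm (y ^ n / pochhammer (a + 1) n) \<le> y ^ n / fact n" for n
    using inc_gamma_series_term_le[OF assms, of n] assms pochhammer_pos[of "a+1" n] by simp
qed

text \<open>Strictness is asked at index 1 because the series to be compared share the term 1 at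
  index 0.\<close>

lemma suminf_less_at_1:
  fixes f g :: "nat \<Rightarrow> real"
  assumes "summable f" "summable g" "\<And>n. f n \<le> g n" "f 1 < g 1"
  shows "suminf f < suminf g"
proof -
  have "0 < (\<Sum>n. g n - f n)"
    using assms by (intro suminf_pos2[where i = 1] summable_diff) auto
  then show ?thesis using assms by (simp add: suminf_diff[symmetric])
qed

lemma inc_gamma_series_strict_antimono:
  assumes "0 < a" "a < b" "0 < y"
  shows "inc_gamma_series b y < inc_gamma_series a y"
  unfolding inc_gamma_series_def
proof (rule suminf_less_at_1)
  show "y ^ n / pochhammer (b + 1) n \<le> y ^ n / pochhammer (a + 1) n" for n
    using assms pochhammer_mono[of "a + 1" "b + 1" n]
    by (intro divide_left_mono mult_pos_pos pochhammer_pos) auto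
  show "y ^ 1 / pochhammer (b + 1) 1 < y ^ 1 / pochhammer (a + 1) 1"
    using assms by (simp add: divide_strict_left_mono)
qed (use assms summable_inc_gamma_series in auto)

lemma inc_gamma_series_strict_mono:
  assumes "0 < a" "0 < y" "y < z"
  shows "inc_gamma_series a y < inc_gamma_series a z"
  unfolding inc_gamma_series_def
proof (rule suminf_less_at_1)
  show "y ^ n / pochhammer (a + 1) n \<le> z ^ n / pochhammer (a + 1) n" for n
    using assms pochhammer_pos[of "a + 1" n]
    by (intro divide_right_mono power_mono) auto
  show "y ^ 1 / pochhammer (a + 1) 1 < z ^ 1 / pochhammer (a + 1) 1"
    using assms by (simp add: divide_strict_right_mono)
qed (use assms summable_inc_gamma_series in auto)

section \<open>The regularized incomplete gamma function p(a) and its consecutive ratios\<close>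

text \<open>For positive \<open>a\<close> and \<open>y\<close>, the distribution function at
  \<open>y\<close> of the Gamma law with shape \<open>a\<close>; also the value of
  \<open>MarcumP\<close> at x = 0.\<close>

definition reg_inc_gamma :: "real \<Rightarrow> real \<Rightarrow> real" where
  "reg_inc_gamma a y = lower_inc_gamma a y / Gamma a"

lemma einterval_0_ereal: "einterval 0 (ereal y) = {0<..<y}"
  by (auto simp: einterval_def)

text \<open>Supplies the endpoint limits for the fundamental theorem of calculus on the open
  interval, as the integrands may be unbounded at 0. The factor \<open>G\<close> covers both
  antiderivatives in use, t^a / a and t^a exp(-t).\<close>

lemma tendsto_powr_times_ends:
  fixes a y :: real and G :: "real \<Rightarrow> real"
  assumes "0 < a" "0 < y" and "continuous_on UNIV G"
  shows "(((\<lambda>t. t powr a * G t) \<circ> real_of_ereal) \<longlongrightarrow> 0) (at_right 0)"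
    and "(((\<lambda>t. t powr a * G t) \<circ> real_of_ereal) \<longlongrightarrow> y powr a * G y) (at_left (ereal y))"
proof -
  have G: "(G \<longlongrightarrow> G t) (at t)" for t
    using assms by (simp add: continuous_on_eq_continuous_at isCont_def)
  have "(G \<longlongrightarrow> G 0) (at_right 0)"
    using G[of 0] by (rule filterlim_mono[OF _ order_refl at_le]) simp
  moreover have "((\<lambda>t. t powr a) \<longlongrightarrow> 0) (at_right (0::real))"
    using assms(1) by (auto intro!: tendsto_eq_intros tendsto_powr' simp: eventually_at_filter)
  ultimately have "((\<lambda>t. t powr a * G t) \<longlongrightarrow> 0) (at_right 0)"
    by (auto intro: tendsto_eq_intros)
  then show "(((\<lambda>t. t powr a * G t) \<circ> real_of_ereal) \<longlongrightarrow> 0) (at_right 0)"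
    by (simp add: zero_ereal_def ereal_tendsto_simps)
  have "((\<lambda>t. t powr a * G t) \<longlongrightarrow> y powr a * G y) (at y)"
    using assms(2) by (intro tendsto_intros G) auto
  then show "(((\<lambda>t. t powr a * G t) \<circ> real_of_ereal) \<longlongrightarrow> y powr a * G y) (at_left (ereal y))"
    by (auto simp: ereal_tendsto_simps intro: filterlim_mono[OF _ order_refl at_le])
qed

text \<open>The integrand is nonnegative, so the fundamental theorem yields integrability together
  with the value, also for a < 1. It later dominates the gamma integrand.\<close>

lemma powr_integral:
  fixes a y :: real
  assumes "0 < a" "0 < y"
  shows "set_integrable lborel {0<..<y} (\<lambda>t. t powr (a - 1))"
    and "(LBINT t:{0<..<y}. t powr (a - 1)) = y powr a / a"
proof -
  have d: "DERIV (\<lambda>t. t powr a * (1 / a)) t :> t powr (a - 1)" if "0 < ereal t" for t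
    using that assms by (auto intro!: derivative_eq_intros)
  have cont: "isCont (\<lambda>t. t powr (a - 1)) t" if "0 < ereal t" for t
    using that by (intro continuous_intros) auto
  note ends = tendsto_powr_times_ends[OF assms, of "\<lambda>_. 1 / a"]
  have i: "set_integrable lborel (einterval 0 (ereal y)) (\<lambda>t. t powr (a - 1))"
    by (rule interval_integral_FTC_nonneg(1)[OF _ d cont _ ends]) (use assms in auto)
  have v: "(LBINT t=0..y. t powr (a - 1)) = y powr a * (1 / a) - 0"
    by (rule interval_integral_FTC_nonneg(2)[OF _ d cont _ ends]) (use assms in auto)
  show "set_integrable lborel {0<..<y} (\<lambda>t. t powr (a - 1))"
    using i by (simp add: einterval_0_ereal)
  show "(LBINT t:{0<..<y}. t powr (a - 1)) = y powr a / a"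
    using v assms by (simp add: interval_lebesgue_integral_def einterval_0_ereal)
qed

lemma lower_inc_gamma_set:
  assumes "0 < y"
  shows "lower_inc_gamma a y = (LBINT t:{0<..<y}. t powr (a - 1) * exp (- t))"
  using assms by (simp add: lower_inc_gamma_def interval_lebesgue_integral_def einterval_0_ereal)

lemma set_integrable_gamma:
  fixes a y :: real
  assumes "0 < a" "0 < y"
  shows "set_integrable lborel {0<..<y} (\<lambda>t. t powr (a - 1) * exp (- t))"
proof (rule set_integrable_bound[OF powr_integral(1)[OF assms]])
  show "set_borel_measurable lborel {0<..<y} (\<lambda>t. t powr (a - 1) * exp (- t))"
    unfolding set_borel_measurable_def by measurable
qed (auto simp: mult_le_cancel_left1)

text \<open>On the interval, exp(-t) lies between exp(-y) and 1.\<close>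

lemma lower_inc_gamma_bounds:
  assumes "0 < a" "0 < y"
  shows "0 < lower_inc_gamma a y" "lower_inc_gamma a y \<le> y powr a / a"
proof -
  have "exp (- y) * (y powr a / a) = (LBINT t:{0<..<y}. exp (- y) * t powr (a - 1))"
    using powr_integral(2)[OF assms] by simp
  also have "\<dots> \<le> lower_inc_gamma a y"
    unfolding lower_inc_gamma_set[OF assms(2)]
    using powr_integral(1)[OF assms] set_integrable_gamma[OF assms]
    by (intro set_integral_mono) (auto simp: mult.commute intro: mult_left_mono)
  finally show "0 < lower_inc_gamma a y"
    using assms by (smt (verit) divide_pos_pos exp_gt_zero mult_pos_pos powr_gt_zero)
  have "lower_inc_gamma a y \<le> (LBINT t:{0<..<y}. t powr (a - 1))"
    unfolding lower_inc_gamma_set[OF assms(2)]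
    using powr_integral(1)[OF assms] set_integrable_gamma[OF assms]
    by (intro set_integral_mono) (auto simp: mult_le_cancel_left1)
  then show "lower_inc_gamma a y \<le> y powr a / a" using powr_integral(2)[OF assms] by simp
qed

text \<open>Integration by parts, carried out by integrating the derivative \<open>?f\<close> of t^a
  exp(-t), which vanishes at 0.\<close>

lemma lower_inc_gamma_plus1:
  assumes "0 < a" "0 < y"
  shows "lower_inc_gamma (a + 1) y = a * lower_inc_gamma a y - y powr a * exp (- y)"
proof -
  let ?f = "\<lambda>t. a * (t powr (a - 1) * exp (- t)) - t powr (a + 1 - 1) * exp (- t)"
  have int0: "set_integrable lborel {0<..<y} (\<lambda>t. a * (t powr (a - 1) * exp (- t)))"
    using set_integrable_gamma[OF assms] by simp
  have int1: "set_integrable lborel {0<..<y} (\<lambda>t. t powr (a + 1 - 1) * exp (- t))"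
    using set_integrable_gamma[of "a + 1" y] assms by simp
  have "(LBINT t=0..y. ?f t) = y powr a * exp (- y) - 0"
  proof (rule interval_integral_FTC_integrable)
    show "((\<lambda>t. t powr a * exp (- t)) has_vector_derivative ?f t) (at t)" if "0 < ereal t" for t
      using that unfolding has_real_derivative_iff_has_vector_derivative[symmetric]
      by (auto intro!: derivative_eq_intros simp: algebra_simps)
    show "isCont ?f t" if "0 < ereal t" for t
      using that by (intro continuous_intros) auto
    show "set_integrable lborel (einterval 0 (ereal y)) ?f"
      unfolding einterval_0_ereal by (rule set_integral_diff(1)[OF int0 int1])
  qed (use assms in \<open>auto intro!: tendsto_powr_times_ends continuous_on_exp continuous_on_minus\<close>)
  then have "(LBINT t:{0<..<y}. ?f t) = y powr a * exp (- y)"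
    using assms by (simp add: interval_lebesgue_integral_def einterval_0_ereal)
  then show ?thesis
    using set_integral_diff(2)[OF int0 int1] assms by (simp add: lower_inc_gamma_set)
qed

lemma Gamma_plus1_real: "0 < a \<Longrightarrow> Gamma (a + 1) = a * Gamma (a :: real)"
  by (rule Gamma_plus1) (auto elim: nonpos_Ints_cases)

lemma reg_inc_gamma_pos: "0 < a \<Longrightarrow> 0 < y \<Longrightarrow> 0 < reg_inc_gamma a y"
  by (simp add: reg_inc_gamma_def lower_inc_gamma_bounds)

lemma reg_inc_gamma_le:
  assumes "0 < a" "0 < y"
  shows "reg_inc_gamma a y \<le> y powr a / Gamma (a + 1)"
proof -
  have "reg_inc_gamma a y \<le> y powr a / a / Gamma a"
    unfolding reg_inc_gamma_def using assms lower_inc_gamma_bounds(2)[OF assms]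
    by (intro divide_right_mono) auto
  then show ?thesis using assms by (simp add: Gamma_plus1_real)
qed

lemma reg_inc_gamma_plus1:
  assumes "0 < a" "0 < y"
  shows "reg_inc_gamma (a + 1) y = reg_inc_gamma a y - y powr a * exp (- y) / Gamma (a + 1)"
  using assms Gamma_real_pos[OF assms(1)]
  by (simp add: reg_inc_gamma_def Gamma_plus1_real lower_inc_gamma_plus1 diff_divide_distrib)

text \<open>Iterating the recurrence in \<open>a\<close> produces the partial sums of the series
  plus a remainder, which tends to 0 because the normalized function \<open>T\<close> is bounded
  uniformly in its argument.\<close>

lemma reg_inc_gamma_eq_series:
  assumes a: "0 < a" and y: "0 < y"
  shows "reg_inc_gamma a y = y powr a * exp (- y) / Gamma (a + 1) * inc_gamma_series a y"
proof -
  \<comment> \<open>Dividing by the expected prefactor turns the recurrence into T b = 1 + y/(b+1) *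
    T(b+1).\<close>
  define T where "T b = reg_inc_gamma b y * (Gamma (b + 1) * exp y / y powr b)" for b
  have T_step: "T b = 1 + y / (b + 1) * T (b + 1)" if "0 < b" for b
  proof -
    define G where "G = Gamma (b + 1)"
    have G: "0 < G" "Gamma (b + 1 + 1) = (b + 1) * G"
      using that Gamma_plus1_real[of "b + 1"] by (auto simp: G_def)
    have "y / (b + 1) * T (b + 1) = reg_inc_gamma (b + 1) y * (G * exp y / y powr b)"
      unfolding T_def G(2) using that y by (simp add: powr_add)
    also have "\<dots> = T b - y powr b * exp (- y) / G * (G * exp y / y powr b)"
      unfolding reg_inc_gamma_plus1[OF that y] by (simp add: T_def G_def algebra_simps)
    also have "y powr b * exp (- y) / G * (G * exp y / y powr b) = 1"
      using G(1) y by (simp add: exp_minus)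
    finally show ?thesis by simp
  qed
  have T_nonneg: "0 \<le> T b" if "0 < b" for b
    using that y reg_inc_gamma_pos[OF that y] by (simp add: T_def less_imp_le)
  have T_le: "T b \<le> exp y" if "0 < b" for b
  proof -
    \<comment> \<open>The bound obtained by replacing exp(-t) by 1 cancels every dependence on
      \<open>b\<close>.\<close>
    have "T b \<le> y powr b / Gamma (b + 1) * (Gamma (b + 1) * exp y / y powr b)"
      unfolding T_def using that y reg_inc_gamma_le[OF that y] by (intro mult_right_mono) (auto intro: less_imp_le)
    also have "\<dots> = exp y"
      using that y Gamma_real_pos[of "b + 1"] by (simp add: less_imp_neq[symmetric])
    finally show ?thesis .
  qed
  have eq: "T a = (\<Sum>n<N. y ^ n / pochhammer (a + 1) n)
      + y ^ N / pochhammer (a + 1) N * T (a + real N)" for N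
  proof (induction N)
    case (Suc N)
    have "y ^ N / pochhammer (a + 1) N * T (a + real N)
        = y ^ N / pochhammer (a + 1) N
          + y ^ Suc N / pochhammer (a + 1) (Suc N) * T (a + real (Suc N))"
      using T_step[of "a + real N"] a by (simp add: pochhammer_Suc algebra_simps)
    then show ?case using Suc by simp
  qed simp
  \<comment> \<open>The coefficient is the general term of a convergent series, and \<open>T\<close>
    stays between 0 and exp y.\<close>
  have "(\<lambda>N. y ^ N / pochhammer (a + 1) N * T (a + real N)) \<longlonglongrightarrow> 0"
  proof (rule tendsto_sandwich)
    have coeff: "0 \<le> y ^ N / pochhammer (a + 1) N" for N
      using a y pochhammer_pos[of "a + 1" N] by simp
    show "\<forall>\<^sub>F N in sequentially. 0 \<le> y ^ N / pochhammer (a + 1) N * T (a + real N)"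
      using a by (intro always_eventually allI mult_nonneg_nonneg[OF coeff] T_nonneg) simp
    show "\<forall>\<^sub>F N in sequentially. y ^ N / pochhammer (a + 1) N * T (a + real N)
        \<le> y ^ N / pochhammer (a + 1) N * exp y"
      using a by (intro always_eventually allI mult_left_mono[OF _ coeff] T_le) simp
    show "(\<lambda>N. y ^ N / pochhammer (a + 1) N * exp y) \<longlonglongrightarrow> 0"
      using summable_LIMSEQ_zero[OF summable_inc_gamma_series, of a y] a y by (intro tendsto_mult_left_zero) auto
  qed simp
  moreover have "(\<lambda>N. \<Sum>n<N. y ^ n / pochhammer (a + 1) n) \<longlonglongrightarrow> inc_gamma_series a y"
    unfolding inc_gamma_series_def using a y by (intro summable_LIMSEQ summable_inc_gamma_series) auto
  ultimately have "(\<lambda>N. (\<Sum>n<N. y ^ n / pochhammer (a + 1) n)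
      + y ^ N / pochhammer (a + 1) N * T (a + real N)) \<longlonglongrightarrow> inc_gamma_series a y + 0"
    by (intro tendsto_add)
  then have "(\<lambda>N. T a) \<longlonglongrightarrow> inc_gamma_series a y" by (simp only: eq[symmetric] add_0_right)
  then have "T a = inc_gamma_series a y" by (simp add: LIMSEQ_const_iff)
  then show ?thesis
    using a y Gamma_real_pos[of "a + 1"] less_imp_neq[OF Gamma_real_pos[of "a + 1"]]
    by (simp add: T_def exp_minus field_simps)
qed

lemma inc_gamma_series_pos: "0 < a \<Longrightarrow> 0 < y \<Longrightarrow> 0 < inc_gamma_series a y"
  unfolding inc_gamma_series_def by (intro suminf_pos summable_inc_gamma_series)
    (auto intro!: divide_pos_pos pochhammer_pos)

text \<open>The term subtracted in the recurrence is exactly the prefactor of the series, so only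
  the reciprocal of the series is left after division.\<close>

lemma reg_inc_gamma_ratio:
  assumes "0 < a" "0 < y"
  shows "reg_inc_gamma (a + 1) y / reg_inc_gamma a y = 1 - 1 / inc_gamma_series a y"
proof -
  have "reg_inc_gamma (a + 1) y / reg_inc_gamma a y
      = 1 - (y powr a * exp (- y) / Gamma (a + 1)) / reg_inc_gamma a y"
    using reg_inc_gamma_pos[OF assms] by (simp add: reg_inc_gamma_plus1[OF assms] diff_divide_distrib)
  also have "(y powr a * exp (- y) / Gamma (a + 1)) / reg_inc_gamma a y = 1 / inc_gamma_series a y"
    using assms inc_gamma_series_pos[OF assms] Gamma_real_pos[of "a + 1"]
    by (simp add: reg_inc_gamma_eq_series less_imp_neq[symmetric])
  finally show ?thesis .
qed

lemma reg_inc_gamma_ratio_antimono: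
  assumes "0 < a" "a < b" "0 < y"
  shows "reg_inc_gamma (b + 1) y / reg_inc_gamma b y < reg_inc_gamma (a + 1) y / reg_inc_gamma a y"
  using assms inc_gamma_series_strict_antimono[of a b y] inc_gamma_series_pos[of b y] inc_gamma_series_pos[of a y]
  by (simp add: reg_inc_gamma_ratio divide_strict_left_mono)

lemma reg_inc_gamma_ratio_mono:
  assumes "0 < a" "0 < y" "y < z"
  shows "reg_inc_gamma (a + 1) y / reg_inc_gamma a y < reg_inc_gamma (a + 1) z / reg_inc_gamma a z"
  using assms inc_gamma_series_strict_mono[of a y z] inc_gamma_series_pos[of a y] inc_gamma_series_pos[of a z]
  by (simp add: reg_inc_gamma_ratio divide_strict_left_mono)

text \<open>The recurrence subtracts a nonnegative term. Integer shifts suffice for dominating the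
  Poisson mixture by an exponential series.\<close>

lemma reg_inc_gamma_antimono:
  assumes "0 < a" "0 < y" shows "reg_inc_gamma (a + real n) y \<le> reg_inc_gamma a y"
proof (induction n)
  case (Suc n)
  have "reg_inc_gamma (a + real n + 1) y \<le> reg_inc_gamma (a + real n) y"
    using reg_inc_gamma_plus1[of "a + real n" y] assms by simp
  then show ?case using Suc by (simp add: algebra_simps)
qed simp

section \<open>The Marcum function as a Poisson mixture\<close>

lemma summable_Poisson_reg_inc_gamma:
  assumes "0 < a" "0 < y" "0 \<le> x"
  shows "summable (\<lambda>k. x ^ k / fact k * reg_inc_gamma (a + real k) y)"
proof (rule summable_comparison_test')
  show "summable (\<lambda>k. x ^ k / fact k * reg_inc_gamma a y)"
    using summable_exp[of x] by (intro summable_mult2) (simp add: field_simps)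
  show "norm (x ^ k / fact k * reg_inc_gamma (a + real k) y) \<le> x ^ k / fact k * reg_inc_gamma a y" for k
  proof -
    have "x ^ k / fact k * reg_inc_gamma (a + real k) y \<le> x ^ k / fact k * reg_inc_gamma a y"
      using assms by (intro mult_left_mono reg_inc_gamma_antimono) auto
    then show ?thesis
      using assms reg_inc_gamma_pos[of "a + real k" y] by simp
  qed
qed

text \<open>The product is 1 for k = 0 and at least \<open>a\<close> otherwise; the sum of the two
  reciprocals bounds both cases uniformly in \<open>k\<close>.\<close>

lemma inverse_pochhammer_le:
  fixes a :: real
  assumes "0 < a"
  shows "1 / pochhammer a k \<le> 1 + 1 / a"
proof (cases k)
  case (Suc n)
  have "1 \<le> pochhammer (a + 1) n"
    using fact_le_pochhammer[OF assms, of n] fact_ge_1[of n, where 'a=real] by linarith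
  then have "a \<le> pochhammer a k" using assms by (simp add: Suc pochhammer_rec)
  then have "1 / pochhammer a k \<le> 1 / a" using assms by (intro divide_left_mono) auto
  then show ?thesis by simp
qed (use assms in auto)

text \<open>Writing Gamma(a+k) as Gamma(a) times a Pochhammer product reduces the claim to the
  exponential series.\<close>

lemma summable_Bessel_series:
  fixes a z :: real
  assumes "0 < a" "0 \<le> z"
  shows "summable (\<lambda>k. z ^ k / (fact k * Gamma (a + real k)))"
proof (rule summable_comparison_test')
  show "summable (\<lambda>k. z ^ k / fact k * ((1 + 1 / a) / Gamma a))"
    using summable_exp[of z] by (intro summable_mult2) (simp add: field_simps)
  fix k
  have pos: "0 < Gamma a" "0 < pochhammer a k" using assms pochhammer_pos by auto
  have "Gamma (a + real k) = Gamma a * pochhammer a k"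
    using assms by (subst pochhammer_Gamma) (auto elim: nonpos_Ints_cases simp: less_imp_neq[symmetric])
  then have "z ^ k / (fact k * Gamma (a + real k)) = z ^ k / fact k * (1 / pochhammer a k / Gamma a)"
    by simp
  also have "\<dots> \<le> z ^ k / fact k * ((1 + 1 / a) / Gamma a)"
    using inverse_pochhammer_le[OF assms(1), of k] assms pos
    by (intro mult_left_mono divide_right_mono) auto
  finally show "norm (z ^ k / (fact k * Gamma (a + real k))) \<le> z ^ k / fact k * ((1 + 1 / a) / Gamma a)"
    using assms by simp
qed

text \<open>The prefactor of the Marcum function cancels the power of \<open>x\<close> coming out of
  the Bessel series, and the two half powers of \<open>t\<close> merge, leaving multiples of gamma
  integrands.\<close>

lemma Marcum_integrand_series:
  fixes \<mu> x t :: real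
  assumes "0 < \<mu>" "0 < x" "0 < t"
  shows "x powr ((1 - \<mu>) / 2) * (t powr ((\<mu> - 1) / 2) * exp (- t - x) * BesselI (\<mu> - 1) (2 * sqrt (x * t)))
     = (\<Sum>k. exp (- x) * (x ^ k / (fact k * Gamma (\<mu> + real k))) * (t powr (\<mu> + real k - 1) * exp (- t)))"
    (is "?L = suminf ?f")
    and "summable (\<lambda>k. exp (- x) * (x ^ k / (fact k * Gamma (\<mu> + real k))) * (t powr (\<mu> + real k - 1) * exp (- t)))"
proof -
  define b where "b k = (x * t) ^ k / (fact k * Gamma (\<mu> + real k))" for k
  have b: "summable b" unfolding b_def using assms by (intro summable_Bessel_series) auto
  have "(2 * sqrt (x * t) / 2) powr (2 * real k + (\<mu> - 1)) / (fact k * Gamma (real k + (\<mu> - 1) + 1))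
      = (x powr ((\<mu> - 1) / 2) * t powr ((\<mu> - 1) / 2)) * b k" for k
  proof -
    have "(2 * sqrt (x * t) / 2) powr (2 * real k + (\<mu> - 1)) = (x * t) powr (1/2 * (2 * real k + (\<mu> - 1)))"
      using assms by (simp add: powr_half_sqrt[symmetric] powr_powr)
    \<comment> \<open>The square root halves the exponent, so integer powers of x * t split
      off.\<close>
    also have "1/2 * (2 * real k + (\<mu> - 1)) = real k + (\<mu> - 1) / 2" by (simp add: field_simps)
    also have "(x * t) powr (real k + (\<mu> - 1) / 2)
        = (x * t) ^ k * (x powr ((\<mu> - 1) / 2) * t powr ((\<mu> - 1) / 2))"
      using assms by (simp add: powr_add powr_realpow powr_mult power_mult_distrib)
    finally show ?thesis by (simp add: b_def add.commute)
  qed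
  then have I: "BesselI (\<mu> - 1) (2 * sqrt (x * t))
      = (x powr ((\<mu> - 1) / 2) * t powr ((\<mu> - 1) / 2)) * suminf b"
    unfolding BesselI_def using b by (simp only: suminf_mult)
  have x1: "x powr ((1 - \<mu>) / 2) * x powr ((\<mu> - 1) / 2) = 1"
    using assms by (simp add: powr_add[symmetric] add_divide_distrib[symmetric])
  have t1: "t powr ((\<mu> - 1) / 2) * t powr ((\<mu> - 1) / 2) = t powr (\<mu> - 1)"
    by (simp add: powr_add[symmetric])
  have "?L = (x powr ((1 - \<mu>) / 2) * x powr ((\<mu> - 1) / 2))
      * (t powr ((\<mu> - 1) / 2) * t powr ((\<mu> - 1) / 2)) * (exp (- x) * exp (- t)) * suminf b"
    unfolding I by (simp add: exp_add[symmetric] mult_ac)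
  then have L: "?L = (t powr (\<mu> - 1) * exp (- x) * exp (- t)) * suminf b"
    unfolding x1 t1 by simp
  have f: "?f k = (t powr (\<mu> - 1) * exp (- x) * exp (- t)) * b k" for k
    using assms powr_add[of t "\<mu> - 1" "real k"]
    by (simp add: b_def powr_realpow power_mult_distrib algebra_simps)
  show "?L = suminf ?f" unfolding L f using b by (simp only: suminf_mult)
  show "summable ?f" unfolding f using b by (rule summable_mult)
qed

text \<open>For positive \<open>x\<close>, the expanded integrand is integrated term by term. The
  terms are nonnegative, so the summability of their norms needed for the exchange is that of the
  Poisson mixture itself.\<close>

lemma MarcumP_series:
  assumes mu: "0 < \<mu>" and x: "0 \<le> x" and y: "0 < y"
  shows "MarcumP \<mu> x y = exp (- x) * (\<Sum>k. x ^ k / fact k * reg_inc_gamma (\<mu> + real k) y)"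
proof (cases "x = 0")
  case True
  \<comment> \<open>With 0 ^ 0 = 1 only the term k = 0 remains.\<close>
  have "(\<Sum>k. x ^ k / fact k * reg_inc_gamma (\<mu> + real k) y)
      = (\<Sum>k. reg_inc_gamma (\<mu> + real k) y / fact k * 0 ^ k)"
    by (simp add: True mult_ac)
  also have "\<dots> = reg_inc_gamma \<mu> y" by (subst powser_zero) simp
  finally show ?thesis by (simp add: MarcumP_def True reg_inc_gamma_def)
next
  case False
  then have x: "0 < x" using x by simp
  define g where "g k t = exp (- x) * (x ^ k / (fact k * Gamma (\<mu> + real k)))
      * (t powr (\<mu> + real k - 1) * exp (- t))" for k t
  define f where "f k t = indicator {0<..<y} t *\<^sub>R g k t" for k t
  have g_nonneg: "0 \<le> g k t" for k t
    using mu x unfolding g_def by (intro mult_nonneg_nonneg divide_nonneg_nonneg) auto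
  have int: "integrable lborel (f k)" for k
    using set_integrable_gamma[of "\<mu> + real k" y] mu y
    unfolding f_def g_def set_integrable_def[symmetric] by (intro set_integrable_mult_right) auto
  have val: "integral\<^sup>L lborel (f k) = exp (- x) * (x ^ k / fact k * reg_inc_gamma (\<mu> + real k) y)" for k
    unfolding f_def g_def set_lebesgue_integral_def[symmetric]
    using y by (simp add: lower_inc_gamma_set reg_inc_gamma_def)
  have sum_f: "summable (\<lambda>k. norm (f k t))" for t
  proof (cases "t \<in> {0<..<y}")
    case True
    then have "summable (\<lambda>k. g k t)"
      unfolding g_def using Marcum_integrand_series(2)[OF mu x, of t] by simp
    then show ?thesis using True g_nonneg by (simp add: f_def)
  qed (simp add: f_def)
  have norm_f: "norm (f k t) = f k t" for k t using g_nonneg by (simp add: f_def)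
  have sum_int: "summable (\<lambda>k. \<integral>t. norm (f k t) \<partial>lborel)"
    unfolding norm_f val using summable_Poisson_reg_inc_gamma[OF mu y, of x] x by (intro summable_mult) auto
  have "MarcumP \<mu> x y = (LBINT t:{0<..<y}. x powr ((1 - \<mu>) / 2) *
        (t powr ((\<mu> - 1) / 2) * exp (- t - x) * BesselI (\<mu> - 1) (2 * sqrt (x * t))))"
    using x y by (simp add: MarcumP_def interval_lebesgue_integral_def einterval_0_ereal)
  also have "\<dots> = (LBINT t:{0<..<y}. \<Sum>k. g k t)"
    by (rule set_lebesgue_integral_cong)
      (use Marcum_integrand_series(1)[OF mu x] in \<open>auto simp: g_def\<close>)
  \<comment> \<open>The indicator moves inside the sum, so that all terms are functions on the whole
    line.\<close>
  also have "\<dots> = (\<integral>t. (\<Sum>k. f k t) \<partial>lborel)"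
    unfolding set_lebesgue_integral_def
    by (intro Bochner_Integration.integral_cong) (auto simp: f_def indicator_def)
  also have "\<dots> = (\<Sum>k. integral\<^sup>L lborel (f k))"
    by (rule integral_suminf[OF int AE_I2[OF sum_f] sum_int])
  also have "\<dots> = exp (- x) * (\<Sum>k. x ^ k / fact k * reg_inc_gamma (\<mu> + real k) y)"
    unfolding val using summable_Poisson_reg_inc_gamma[OF mu y, of x] x by (intro suminf_mult) auto
  finally show ?thesis .
qed

section \<open>Monotonicity of the ratio h\<close>

lemma h_ratio_series:
  assumes "0 < \<mu>" "0 \<le> x" "0 < y"
  shows "h_ratio \<mu> x y = (\<Sum>k. x ^ k / fact k * reg_inc_gamma (\<mu> + 1 + real k) y)
                          / (\<Sum>k. x ^ k / fact k * reg_inc_gamma (\<mu> + real k) y)"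
  using assms by (simp add: h_ratio_def MarcumP_series)

lemma h_ratio_0: "h_ratio \<mu> 0 y = reg_inc_gamma (\<mu> + 1) y / reg_inc_gamma \<mu> y"
  by (simp add: h_ratio_def MarcumP_def reg_inc_gamma_def)

text \<open>Since k * x^k / k! = x * x^(k-1) / (k-1)!, the numerator of h is, up to the factor
  \<open>x\<close>, the first moment of the weights in its denominator. The averaged quantity
  \<open>k\<close> does not involve \<mu> or \<open>y\<close>, so changing these affects the weights
  alone.\<close>

lemma h_ratio_as_mean:
  assumes "0 < \<mu>" "0 < x" "0 < y"
  shows "h_ratio \<mu> x y * x = (\<Sum>k. real k * (x ^ k / fact k * reg_inc_gamma (\<mu> + real k) y))
                          / (\<Sum>k. x ^ k / fact k * reg_inc_gamma (\<mu> + real k) y)"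
    and "summable (\<lambda>k. real k * (x ^ k / fact k * reg_inc_gamma (\<mu> + real k) y))"
proof -
  let ?f = "\<lambda>k. real k * (x ^ k / fact k * reg_inc_gamma (\<mu> + real k) y)"
  have s: "summable (\<lambda>k. x ^ k / fact k * reg_inc_gamma (\<mu> + 1 + real k) y)"
    using assms by (intro summable_Poisson_reg_inc_gamma) auto
  have shift: "?f (Suc k) = x * (x ^ k / fact k * reg_inc_gamma (\<mu> + 1 + real k) y)" for k
    by (simp add: field_simps del: of_nat_Suc) (simp add: algebra_simps)
  have "summable (\<lambda>k. ?f (Suc k))" unfolding shift by (rule summable_mult[OF s])
  then show f: "summable ?f" by (subst (asm) summable_Suc_iff)
  have "suminf ?f = (\<Sum>k. ?f (Suc k))" using suminf_split_head[OF f] by simp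
  also have "\<dots> = x * (\<Sum>k. x ^ k / fact k * reg_inc_gamma (\<mu> + 1 + real k) y)"
    unfolding shift by (rule suminf_mult[OF s])
  finally show "h_ratio \<mu> x y * x = suminf ?f / (\<Sum>k. x ^ k / fact k * reg_inc_gamma (\<mu> + real k) y)"
    using assms by (simp add: h_ratio_series)
qed

text \<open>Assumption \<open>q\<close>, cross-multiplied, says that the quotient of the two weight
  sequences decreases in \<open>k\<close>; the means of \<open>k\<close> then compare. This form
  serves a change of \<open>y\<close> and a change of \<mu> alike.\<close>

lemma h_ratio_less:
  assumes "0 < \<mu>" "0 < \<nu>" "0 < x" "0 < y" "0 < z"
    and q: "\<And>k. reg_inc_gamma (\<mu> + real k + 1) y / reg_inc_gamma (\<mu> + real k) y
               < reg_inc_gamma (\<nu> + real k + 1) z / reg_inc_gamma (\<nu> + real k) z"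
  shows "h_ratio \<mu> x y < h_ratio \<nu> x z"
proof -
  let ?u = "\<lambda>k. x ^ k / fact k * reg_inc_gamma (\<mu> + real k) y"
  let ?v = "\<lambda>k. x ^ k / fact k * reg_inc_gamma (\<nu> + real k) z"
  have pos: "0 < reg_inc_gamma (\<mu> + real k) y" "0 < reg_inc_gamma (\<nu> + real k) z" for k
    using assms by (auto intro!: reg_inc_gamma_pos)
  have uv: "?u (Suc k) / ?v (Suc k) < ?u k / ?v k" for k
  proof -
    have step: "?u (Suc k) / ?v (Suc k) = reg_inc_gamma (\<mu> + real k + 1) y / reg_inc_gamma (\<nu> + real k + 1) z"
      "?u k / ?v k = reg_inc_gamma (\<mu> + real k) y / reg_inc_gamma (\<nu> + real k) z"
      using assms(3) by (simp_all add: add_ac)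
    show ?thesis
      unfolding step using q[of k] pos[of k] pos[of "Suc k"] by (simp add: field_simps)
  qed
  have "(\<Sum>k. real k * ?u k) / (\<Sum>k. ?u k) < (\<Sum>k. real k * ?v k) / (\<Sum>k. ?v k)"
  proof (rule weighted_mean_less)
    show "0 < ?v k" "0 \<le> ?u k" for k using assms pos[of k] by auto
    show "?u (Suc k) / ?v (Suc k) \<le> ?u k / ?v k" for k using uv[of k] by simp
    show "?u 1 / ?v 1 < ?u 0 / ?v 0" using uv[of 0] by simp
    show "summable ?u" "summable ?v"
      using assms by (simp_all only: summable_Poisson_reg_inc_gamma less_imp_le)
    show "summable (\<lambda>k. real k * ?u k)" "summable (\<lambda>k. real k * ?v k)"
      using assms by (simp_all only: h_ratio_as_mean(2))
  qed simp_all
  then have "h_ratio \<mu> x y * x < h_ratio \<nu> x z * x"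
    using assms by (simp add: h_ratio_as_mean)
  then show ?thesis using assms by simp
qed

text \<open>Here h is read as the mean of the ratios p(\<mu>+k+1)/p(\<mu>+k), which do not depend on
  \<open>x\<close> and decrease in \<open>k\<close>, while a larger \<open>x\<close> shifts weight
  to larger \<open>k\<close>. This reading also covers x1 = 0.\<close>

lemma h_ratio_antimono_x:
  assumes mu: "0 < \<mu>" and x: "0 \<le> x1" "x1 < x2" and y: "0 < y"
  shows "h_ratio \<mu> x2 y < h_ratio \<mu> x1 y"
proof -
  \<comment> \<open>The sign makes \<open>c\<close> increasing, as the inequality for means
    requires; it is undone in \<open>h\<close>.\<close>
  define c where "c k = - (reg_inc_gamma (\<mu> + 1 + real k) y / reg_inc_gamma (\<mu> + real k) y)" for k
  define w where "w x k = x ^ k / fact k * reg_inc_gamma (\<mu> + real k) y" for x k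
  have pos: "0 < reg_inc_gamma (\<mu> + real k) y" for k using mu y by (intro reg_inc_gamma_pos) auto
  have cw: "c k * w x k = - (x ^ k / fact k * reg_inc_gamma (\<mu> + 1 + real k) y)" for x k
    using pos[of k] by (simp add: c_def w_def)
  have c: "c k < c (Suc k)" for k
    using reg_inc_gamma_ratio_antimono[of "\<mu> + real k" "\<mu> + 1 + real k" y] mu y
    by (simp add: c_def algebra_simps)
  \<comment> \<open>The common gamma factor cancels. The quotient is geometric with ratio below 1,
    and for x1 = 0 it is 1, 0, 0, ...\<close>
  have quot: "w x1 k / w x2 k = (x1 / x2) ^ k" for k
    using pos[of k] x by (simp add: w_def power_divide)
  have s: "summable (\<lambda>k. x ^ k / fact k * reg_inc_gamma (\<mu> + 1 + real k) y)" if "0 \<le> x" for x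
    using that mu y by (intro summable_Poisson_reg_inc_gamma) auto
  have sw: "summable (w x)" if "0 \<le> x" for x
    unfolding w_def using that mu y by (intro summable_Poisson_reg_inc_gamma) auto
  have h: "(\<Sum>k. c k * w x k) / suminf (w x) = - h_ratio \<mu> x y" if "0 \<le> x" for x
    unfolding cw using that mu y s[OF that] by (simp add: suminf_minus h_ratio_series w_def[abs_def])
  have "(\<Sum>k. c k * w x1 k) / suminf (w x1) < (\<Sum>k. c k * w x2 k) / suminf (w x2)"
  proof (rule weighted_mean_less)
    show "c k \<le> c (Suc k)" for k using c[of k] by simp
    show "c 0 < c 1" using c[of 0] by simp
    show "0 < w x2 k" "0 \<le> w x1 k" for k using pos[of k] x by (auto simp: w_def)
    show "w x1 (Suc k) / w x2 (Suc k) \<le> w x1 k / w x2 k" for k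
      unfolding quot using x by (intro power_decreasing) auto
    show "w x1 1 / w x2 1 < w x1 0 / w x2 0" unfolding quot using x by simp
    show "summable (\<lambda>k. c k * w x1 k)" "summable (\<lambda>k. c k * w x2 k)"
      unfolding cw using s x by (auto intro!: summable_minus)
  qed (use sw x in auto)
  then show ?thesis using h[of x1] h[of x2] x by simp
qed

theorem theorem4:
  shows "(\<forall>\<mu> x y1 y2. 0 < \<mu> \<and> 0 \<le> x \<and> 0 < y1 \<and> y1 < y2 \<longrightarrow>
            h_ratio \<mu> x y1 < h_ratio \<mu> x y2)
       \<and> (\<forall>\<mu> x1 x2 y. 0 < \<mu> \<and> 0 \<le> x1 \<and> x1 < x2 \<and> 0 < y \<longrightarrow>
            h_ratio \<mu> x2 y < h_ratio \<mu> x1 y)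
       \<and> (\<forall>\<mu>1 \<mu>2 x y. 0 < \<mu>1 \<and> \<mu>1 < \<mu>2 \<and> 0 \<le> x \<and> 0 < y \<longrightarrow>
            h_ratio \<mu>2 x y < h_ratio \<mu>1 x y)"
proof (intro conjI allI impI; elim conjE)
  fix \<mu> x y1 y2 :: real
  assume "0 < \<mu>" "0 \<le> x" "0 < y1" "y1 < y2"
  then show "h_ratio \<mu> x y1 < h_ratio \<mu> x y2"
    \<comment> \<open>The mean of \<open>k\<close> represents h * x and says nothing at x = 0; there
      h is the single ratio p(\<mu>+1)/p(\<mu>), whose monotonicity is already known. The claim
      about \<mu> splits in the same way.\<close>
    by (cases "x = 0") (auto simp: h_ratio_0 intro!: h_ratio_less reg_inc_gamma_ratio_mono)
next
  fix \<mu> x1 x2 y :: real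
  assume "0 < \<mu>" "0 \<le> x1" "x1 < x2" "0 < y"
  then show "h_ratio \<mu> x2 y < h_ratio \<mu> x1 y" by (rule h_ratio_antimono_x)
next
  fix \<mu>1 \<mu>2 x y :: real
  assume "0 < \<mu>1" "\<mu>1 < \<mu>2" "0 \<le> x" "0 < y"
  then show "h_ratio \<mu>2 x y < h_ratio \<mu>1 x y"
    by (cases "x = 0") (auto simp: h_ratio_0 intro!: h_ratio_less reg_inc_gamma_ratio_antimono)
qed

end
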